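(* For every $b\in(0,\infty)$, the set $\mathcal{A}_b$ is dense in $\mathcal{Y}_b$ with respect to the distance $\mathrm{d}$.
   Context: $\mathcal{Y}_{\mathrm{conc}}$ (the concave Young-functions) is the set of all functions $\Phi:[0,\infty)\to[0,\infty)$ of the form $\Phi(x)=\int_0^x\varphi(t)\,dt$, where $\varphi:(0,\infty)\to(0,\infty)$ is right-continuous, decreasing and integrable on every finite interval $(0,x)$, and $\Phi(\infty):=\lim_{x\to\infty}\Phi(x)=\infty$. Here "decreasing" is meant strictly, so every function in $\mathcal{Y}_{\mathrm{conc}}$ is strictly concave. $\mathcal{A}$ is the set of $\Phi\in\mathcal{Y}_{\mathrm{conc}}$ with $\int_1^\infty\frac{\varphi(t)}{t}\,dt<\infty$. For $b\in(0,\infty)$, $\mathcal{A}_b:=\{\Phi\in\mathcal{A}:\Phi(b)=b\}$ and $\mathcal{Y}_b:=\{\Phi\in\mathcal{Y}_{\mathrm{conc}}:\Phi(b)=b\}$. The distance on $\mathcal{Y}_{\mathrm{conc}}$ is $\mathrm{d}(f,g)=\sqrt{\int_0^\infty\frac{(f(x)-g(x))^2}{(x+1)^4}\,dx}$ (it is finite on $\mathcal{Y}_{\mathrm{conc}}$). *)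

theory Defs
  imports "HOL-Analysis.Analysis"
begin

text \<open>A function on \<open>[0,\<infinity>)\<close> is an element of \<open>{0..} \<rightarrow>\<^sub>E _\<close> (value \<open>undefined\<close> at
  negative arguments), so that equality of functions is equality on \<open>[0,\<infinity>)\<close>.  The density
  \<open>\<phi>\<close> is only ever inspected on \<open>(0,\<infinity>)\<close>.\<close>

definition conc_density :: "(real \<Rightarrow> real) \<Rightarrow> (real \<Rightarrow> real) \<Rightarrow> bool" where
  "conc_density \<phi> \<Phi> \<longleftrightarrow>
     \<phi> \<in> {0<..} \<rightarrow> {0<..} \<and>
     (\<forall>t>0. continuous (at_right t) \<phi>) \<and>
     (\<forall>s t. 0 < s \<longrightarrow> s < t \<longrightarrow> \<phi> t < \<phi> s) \<and>
     (\<forall>x>0. set_integrable lborel {0<..<x} \<phi>) \<and>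
     (\<forall>x\<ge>0. \<Phi> x = (LINT t:{0<..<x}|lborel. \<phi> t))"

definition Y_conc :: "(real \<Rightarrow> real) set" where
  "Y_conc = {\<Phi> \<in> {0..} \<rightarrow>\<^sub>E {0..}. (\<exists>\<phi>. conc_density \<phi> \<Phi>) \<and> filterlim \<Phi> at_top at_top}"

text \<open>\<open>\<phi>\<close> is determined on \<open>(0,\<infinity>)\<close> by \<open>\<Phi>\<close> (it is the right derivative), so the existential
  quantifier below speaks about the density of \<open>\<Phi>\<close>.  As \<open>\<phi>(t)/t\<close> is positive and
  measurable on \<open>[1,\<infinity>)\<close>, integrability is finiteness of the integral.\<close>

definition A_conc :: "(real \<Rightarrow> real) set" where
  "A_conc = {\<Phi> \<in> Y_conc. \<exists>\<phi>. conc_density \<phi> \<Phi> \<and> set_integrable lborel {1..} (\<lambda>t. \<phi> t / t)}"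

definition Y_at :: "real \<Rightarrow> (real \<Rightarrow> real) set" where
  "Y_at b = {\<Phi> \<in> Y_conc. \<Phi> b = b}"

definition A_at :: "real \<Rightarrow> (real \<Rightarrow> real) set" where
  "A_at b = {\<Phi> \<in> A_conc. \<Phi> b = b}"

definition dist_conc :: "(real \<Rightarrow> real) \<Rightarrow> (real \<Rightarrow> real) \<Rightarrow> real" where
  "dist_conc f g = sqrt (LINT x:{0..}|lborel. (f x - g x)\<^sup>2 / (x + 1) ^ 4)"

text \<open>The integral in \<^const>\<open>dist_conc\<close> converges on \<^const>\<open>Y_conc\<close>, so the convention that a
  divergent integral is \<open>0\<close> plays no role there.\<close>

lemma Y_conc_bounds:
  assumes "\<Phi> \<in> Y_conc"
  obtains C where "C \<ge> 0" "\<And>x. x \<ge> 0 \<Longrightarrow> 0 \<le> \<Phi> x \<and> \<Phi> x \<le> C * (x + 1)"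
    and "mono_on {0..} \<Phi>"
proof -
  from assms obtain \<phi> where d: "conc_density \<phi> \<Phi>" and P: "\<Phi> \<in> {0..} \<rightarrow>\<^sub>E {0..}"
    by (auto simp: Y_conc_def)
  have pos: "\<phi> t > 0" if "t > 0" for t using d that by (auto simp: conc_density_def)
  have int: "set_integrable lborel {0<..<x} \<phi>" for x
    using d by (cases "x > 0") (auto simp: conc_density_def set_integrable_def)
  have eq: "\<Phi> x = (LINT t:{0<..<x}|lborel. \<phi> t)" if "x \<ge> 0" for x
    using d that by (auto simp: conc_density_def)
  have dec: "\<phi> t < \<phi> s" if "0 < s" "s < t" for s t
    using d that by (auto simp: conc_density_def)
  have mono: "mono_on {0..} \<Phi>"
  proof (rule mono_onI)
    fix r s :: real assume rs: "r \<in> {0..}" "s \<in> {0..}" "r \<le> s"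
    have "(LINT t:{0<..<r}|lborel. \<phi> t) \<le> (LINT t:{0<..<s}|lborel. \<phi> t)"
      unfolding set_lebesgue_integral_def
      using int[of r] int[of s] rs pos
      by (intro integral_mono) (auto simp: set_integrable_def indicator_def less_imp_le)
    then show "\<Phi> r \<le> \<Phi> s" using rs by (simp add: eq)
  qed
  have nn: "0 \<le> \<Phi> x" if "x \<ge> 0" for x using P that by (auto simp: PiE_def Pi_def)
  have up: "\<Phi> x \<le> \<Phi> 1 + \<phi> 1 * x" if "x \<ge> 0" for x
  proof -
    have i1: "integrable lborel (\<lambda>t. indicator {0<..<1} t * \<phi> t)"
      using int[of 1] by (simp add: set_integrable_def)
    have i2: "integrable lborel (\<lambda>t. indicator {0<..<x} t * \<phi> 1)"
      using that by (intro integrable_mult_left integrable_real_indicator) auto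
    have "\<Phi> x \<le> (LINT t|lborel. indicator {0<..<1} t * \<phi> t + indicator {0<..<x} t * \<phi> 1)"
      unfolding eq[OF that] set_lebesgue_integral_def
    proof (rule integral_mono)
      show "integrable lborel (\<lambda>t. indicator {0<..<x} t *\<^sub>R \<phi> t)"
        using int[of x] by (simp add: set_integrable_def)
      show "integrable lborel (\<lambda>t. indicator {0<..<1} t * \<phi> t + indicator {0<..<x} t * \<phi> 1)"
        using i1 i2 by simp
      fix t :: real
      have "\<phi> t \<le> \<phi> 1" if "t \<ge> 1" using dec[of 1 t] that by (cases "t = 1") auto
      then show "indicator {0<..<x} t *\<^sub>R \<phi> t
          \<le> indicator {0<..<1} t * \<phi> t + indicator {0<..<x} t * \<phi> 1"
        using pos[of t] pos[of 1] by (auto simp: indicator_def)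
    qed
    also have "\<dots> = \<Phi> 1 + \<phi> 1 * x"
      using i1 i2 that by (simp add: eq set_lebesgue_integral_def)
    finally show ?thesis .
  qed
  have "0 \<le> \<Phi> x \<and> \<Phi> x \<le> (\<Phi> 1 + \<phi> 1) * (x + 1)" if "x \<ge> 0" for x
  proof -
    have "\<Phi> 1 + \<phi> 1 * x \<le> (\<Phi> 1 + \<phi> 1) * (x + 1)"
      using nn[of 1] pos[of 1] that by (simp add: algebra_simps)
    then show ?thesis using nn[OF that] up[OF that] by linarith
  qed
  then show ?thesis using nn[of 1] pos[of 1] mono by (intro that[of "\<Phi> 1 + \<phi> 1"]) auto
qed

lemma dist_conc_finite:
  assumes f: "f \<in> Y_conc" and g: "g \<in> Y_conc"
  shows "set_integrable lborel {0..} (\<lambda>x. (f x - g x)\<^sup>2 / (x + 1) ^ 4)"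
proof -
  obtain C where C: "C \<ge> 0" "\<And>x. x \<ge> 0 \<Longrightarrow> 0 \<le> f x \<and> f x \<le> C * (x + 1)"
    and mf: "mono_on {0..} f" using Y_conc_bounds[OF f] by blast
  obtain D where D: "D \<ge> 0" "\<And>x. x \<ge> 0 \<Longrightarrow> 0 \<le> g x \<and> g x \<le> D * (x + 1)"
    and mg: "mono_on {0..} g" using Y_conc_bounds[OF g] by blast
  let ?h = "\<lambda>x::real. (C + D)\<^sup>2 / (x + 1)\<^sup>2"
  have "set_integrable lborel (einterval (ereal 0) \<infinity>) ?h"
  proof (rule interval_integral_FTC_nonneg(1)[where F = "\<lambda>x. - ((C + D)\<^sup>2 / (x + 1))"
        and A = "- ((C + D)\<^sup>2)" and B = 0])
    show "((\<lambda>x. - ((C + D)\<^sup>2 / (x + 1))) has_real_derivative ?h x) (at x)"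
      if "ereal 0 < ereal x" for x :: real
      using that by (auto intro!: derivative_eq_intros simp: power2_eq_square divide_simps)
    show "isCont ?h x" if "ereal 0 < ereal x" for x :: real
      using that by (auto intro!: continuous_intros)
    have "((\<lambda>x. - ((C + D)\<^sup>2 / (x + 1))) \<longlongrightarrow> - ((C + D)\<^sup>2 / (0 + 1))) (at_right 0)"
      by (intro tendsto_intros) auto
    then show "(((\<lambda>x. - ((C + D)\<^sup>2 / (x + 1))) \<circ> real_of_ereal) \<longlongrightarrow> - (C + D)\<^sup>2)
        (at_right (ereal 0))"
      by (subst ereal_tendsto_simps) simp
    have "((\<lambda>x::real. (C + D)\<^sup>2 / (x + 1)) \<longlongrightarrow> 0) at_top"
      by (intro tendsto_divide_0[OF tendsto_const] filterlim_at_top_imp_at_infinity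
          filterlim_tendsto_add_at_top[OF tendsto_const, where g = "\<lambda>x. x" and c = 1,
            simplified add.commute] filterlim_ident)
    then have "((\<lambda>x::real. - ((C + D)\<^sup>2 / (x + 1))) \<longlongrightarrow> 0) at_top"
      using tendsto_minus by fastforce
    then show "(((\<lambda>x. - ((C + D)\<^sup>2 / (x + 1))) \<circ> real_of_ereal) \<longlongrightarrow> 0) (at_left \<infinity>)"
      by (subst ereal_tendsto_simps) simp
  qed auto
  then have "set_integrable lborel {0<..} ?h" by (simp only: einterval_eq)
  then have h: "set_integrable lborel {0..} ?h"
    by (rule set_integrable_discrete_difference[where X = "{0}", THEN iffD1, rotated -1]) auto
  have m: "set_borel_measurable borel {0..} u" if "mono_on {0..} u" for u :: "real \<Rightarrow> real"
    using borel_measurable_mono_on_fnc[OF that]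
    by (simp add: set_borel_measurable_def borel_measurable_restrict_space_iff
        mult.commute)
  have "(\<lambda>x. (indicator {0..} x *\<^sub>R f x - indicator {0..} x *\<^sub>R g x)\<^sup>2 / (x + 1) ^ 4)
      \<in> borel_measurable lborel"
    using m[OF mf] m[OF mg] unfolding set_borel_measurable_def by measurable
  also have "(\<lambda>x. (indicator {0..} x *\<^sub>R f x - indicator {0..} x *\<^sub>R g x)\<^sup>2 / (x + 1) ^ 4)
      = (\<lambda>x. indicator {0..} x *\<^sub>R ((f x - g x)\<^sup>2 / (x + 1) ^ 4))"
    by (auto simp: indicator_def)
  finally have meas: "set_borel_measurable lborel {0..} (\<lambda>x. (f x - g x)\<^sup>2 / (x + 1) ^ 4)"
    by (simp add: set_borel_measurable_def)
  show ?thesis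
  proof (rule set_integrable_bound[OF h meas], intro AE_I2 impI)
    fix x :: real assume "x \<in> {0..}"
    then have x: "x \<ge> 0" by simp
    have "\<bar>f x - g x\<bar> \<le> \<bar>(C + D) * (x + 1)\<bar>"
      using C(2)[OF x] D(2)[OF x] C(1) D(1) x by (auto simp: algebra_simps abs_if)
    then have "(f x - g x)\<^sup>2 \<le> ((C + D) * (x + 1))\<^sup>2" by (simp only: abs_le_square_iff)
    then have "(f x - g x)\<^sup>2 / (x + 1) ^ 4 \<le> ((C + D) * (x + 1))\<^sup>2 / (x + 1) ^ 4"
      by (intro divide_right_mono) auto
    also have "\<dots> = ((C + D)\<^sup>2 * (x + 1)\<^sup>2) / ((x + 1)\<^sup>2 * (x + 1)\<^sup>2)"
      by (simp add: power_mult_distrib flip: power_add)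
    also have "\<dots> = ?h x" using x by (intro nonzero_mult_divide_mult_cancel_right) simp
    finally show "norm ((f x - g x)\<^sup>2 / (x + 1) ^ 4) \<le> norm (?h x)" by simp
  qed
qed

end

theory Submission
  imports Defs
begin

text \<open>Given a density \<open>\<phi>\<close> of \<open>f\<close>, keep it on \<open>(0,N)\<close> and replace it on \<open>[N,\<infinity>)\<close> by
  \<open>\<phi>(N) \<surd>(N/t)\<close>.  The resulting function \<open>g\<close> lies in \<open>\<A>\<close>, agrees with \<open>f\<close> on \<open>[0,N]\<close>, and both
  are bounded by \<open>C (x + 1)\<close> with \<open>C = f(1) + \<phi>(1)\<close> independent of \<open>N\<close>.  Hence
  \<open>d(f,g)\<^sup>2 \<le> \<integral>\<^sub>N\<^sup>\<infinity> C\<^sup>2/x\<^sup>2 dx = C\<^sup>2/N\<close>.\<close>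

section \<open>Growth bounds from the density, and tail integrals of powers\<close>

lemma conc_density_integrable:
  assumes "conc_density \<phi> \<Phi>"
  shows "set_integrable lborel {0<..<x} \<phi>"
  using assms by (cases "x > 0") (auto simp: conc_density_def set_integrable_def)

lemma conc_density_nonneg:
  assumes d: "conc_density \<phi> \<Phi>" and x: "0 \<le> x"
  shows "0 \<le> \<Phi> x"
proof -
  have "0 \<le> (LINT t:{0<..<x}|lborel. \<phi> t)"
    unfolding set_lebesgue_integral_def using d
    by (intro integral_nonneg_AE AE_I2) (auto simp: conc_density_def indicator_def Pi_def less_imp_le)
  then show ?thesis using d x by (simp add: conc_density_def)
qed

text \<open>A decreasing density stays above \<open>\<phi> x\<close> on \<open>{0<..<x}\<close>.
  Applied to the cut density, this forces its integral to tend to infinity.\<close>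

lemma conc_density_lower_bound:
  assumes d: "conc_density \<phi> \<Phi>" and x: "0 < x"
  shows "x * \<phi> x \<le> \<Phi> x"
proof -
  have "(LINT t:{0<..<x}|lborel. \<phi> x) \<le> (LINT t:{0<..<x}|lborel. \<phi> t)"
  proof (rule set_integral_mono)
    show "set_integrable lborel {0<..<x} (\<lambda>t. \<phi> x)"
      using x by (simp add: set_integrable_def)
  qed (use d conc_density_integrable in \<open>auto simp: conc_density_def less_imp_le\<close>)
  then show ?thesis using d x by (simp add: conc_density_def set_lebesgue_integral_def)
qed

text \<open>Up to 1 the density itself is kept; from 1 on it is at most \<open>\<phi> 1\<close>.
  Only the data at 1 enter, so a cut beyond 1 leaves the bound unchanged.\<close>

lemma conc_density_upper_bound:
  assumes d: "conc_density \<phi> \<Phi>" and x: "0 \<le> x"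
  shows "\<Phi> x \<le> \<Phi> 1 + \<phi> 1 * x"
proof -
  have pos: "0 < \<phi> t" if "0 < t" for t using d that by (auto simp: conc_density_def)
  have i1: "integrable lborel (\<lambda>t. indicator {0<..<1} t * \<phi> t)"
    using conc_density_integrable[OF d, of 1] by (simp add: set_integrable_def)
  have i2: "integrable lborel (\<lambda>t. indicator {0<..<x} t * \<phi> 1)"
    using x by (intro integrable_mult_left integrable_real_indicator) auto
  have "\<Phi> x = (LINT t:{0<..<x}|lborel. \<phi> t)" using d x by (simp add: conc_density_def)
  also have "\<dots> \<le> (LINT t|lborel. indicator {0<..<1} t * \<phi> t + indicator {0<..<x} t * \<phi> 1)"
    unfolding set_lebesgue_integral_def
  proof (rule integral_mono)
    show "integrable lborel (\<lambda>t. indicator {0<..<x} t *\<^sub>R \<phi> t)"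
      using conc_density_integrable[OF d, of x] by (simp add: set_integrable_def)
    show "integrable lborel (\<lambda>t. indicator {0<..<1} t * \<phi> t + indicator {0<..<x} t * \<phi> 1)"
      using i1 i2 by simp
    fix t :: real
    have "\<phi> t \<le> \<phi> 1" if "t \<ge> 1"
      using d that by (cases "t = 1") (auto simp: conc_density_def less_imp_le)
    then show "indicator {0<..<x} t *\<^sub>R \<phi> t
        \<le> indicator {0<..<1} t * \<phi> t + indicator {0<..<x} t * \<phi> 1"
      using pos[of t] pos[of 1] by (auto simp: indicator_def)
  qed
  also have "\<dots> = \<Phi> 1 + \<phi> 1 * x"
    using i1 i2 x d by (simp add: conc_density_def set_lebesgue_integral_def)
  finally show ?thesis .
qed

text \<open>The exponent -3/2 serves for membership in \<open>A_conc\<close>, the exponent -2 for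
  the distance estimate.\<close>

lemma powr_tail:
  fixes a e :: real
  assumes "a > 0" "e < -1"
  shows "set_integrable lborel {a..} (\<lambda>x. x powr e)"
    and "(LINT x:{a..}|lborel. x powr e) = - (a powr (e + 1)) / (e + 1)"
proof -
  have h: "((\<lambda>x. x powr e) has_integral - (a powr (e + 1)) / (e + 1)) {a..}"
    using has_integral_powr_to_inf[OF assms(2,1)] .
  have "(\<lambda>x. x powr e) absolutely_integrable_on {a..}"
    using h by (intro nonnegative_absolutely_integrable_1) (auto simp: has_integral_integrable)
  \<comment> \<open>Absolute integrability refers to the completion of \<open>lborel\<close>; Borel
    measurability of the integrand brings it back to \<open>lborel\<close>.\<close>
  then show i: "set_integrable lborel {a..} (\<lambda>x. x powr e)"
    unfolding set_integrable_def by (subst (asm) integrable_completion) auto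
  show "(LINT x:{a..}|lborel. x powr e) = - (a powr (e + 1)) / (e + 1)"
    using set_borel_integral_eq_integral(2)[OF i] integral_unique[OF h] by simp
qed

section \<open>The approximating function and its membership in \<open>A_conc\<close>\<close>

text \<open>The tail of order t^(-1/2) decays slowly enough to have infinite integral, yet remains
  integrable after division by t. Its factor gives it the value \<open>\<phi> N\<close> at
  \<open>N\<close>, so monotonicity survives the gluing.\<close>

definition cut_density :: "real \<Rightarrow> (real \<Rightarrow> real) \<Rightarrow> real \<Rightarrow> real" where
  "cut_density N \<phi> t = (if t < N then \<phi> t else \<phi> N * sqrt (N / t))"

text \<open>The restriction to \<open>{0..}\<close> makes the function extensional, as
  \<open>Y_conc\<close> demands.\<close>

definition conc_of_density :: "(real \<Rightarrow> real) \<Rightarrow> real \<Rightarrow> real" where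
  "conc_of_density \<phi> = (\<lambda>x\<in>{0..}. LINT t:{0<..<x}|lborel. \<phi> t)"

lemma conc_density_cut:
  assumes d: "conc_density \<phi> \<Phi>" and N: "0 < N"
  shows "conc_density (cut_density N \<phi>) (conc_of_density (cut_density N \<phi>))"
proof -
  have pos: "0 < \<phi> t" if "0 < t" for t using d that by (auto simp: conc_density_def)
  have dec: "\<phi> t < \<phi> s" if "0 < s" "s < t" for s t using d that by (auto simp: conc_density_def)
  let ?\<psi> = "cut_density N \<phi>"
  have "continuous (at_right t) ?\<psi>" if t: "0 < t" for t
  \<comment> \<open>Only values to the right of t matter: for t < N they are eventually those of
    \<open>\<phi>\<close>, and for t \<ge> N, including t = N, those of the tail.\<close>
  proof (cases "t < N")
    case True
    have "(\<phi> \<longlongrightarrow> \<phi> t) (at_right t)"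
      using d t by (auto simp: conc_density_def continuous_within)
    moreover have "eventually (\<lambda>s. \<phi> s = ?\<psi> s) (at_right t)"
      using eventually_at_right_real[OF True]
      by eventually_elim (simp add: cut_density_def)
    ultimately have "(?\<psi> \<longlongrightarrow> \<phi> t) (at_right t)" by (rule Lim_transform_eventually)
    then show ?thesis using True by (simp add: continuous_within cut_density_def)
  next
    case False
    have "((\<lambda>s. \<phi> N * sqrt (N / s)) \<longlongrightarrow> \<phi> N * sqrt (N / t)) (at_right t)"
      using t by (intro tendsto_intros) auto
    moreover have "eventually (\<lambda>s. \<phi> N * sqrt (N / s) = ?\<psi> s) (at_right t)"
      using eventually_at_right_less[of t]
      by eventually_elim (use False in \<open>simp add: cut_density_def\<close>)
    ultimately have "(?\<psi> \<longlongrightarrow> \<phi> N * sqrt (N / t)) (at_right t)" by (rule Lim_transform_eventually)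
    then show ?thesis using False by (simp add: continuous_within cut_density_def)
  qed
  \<comment> \<open>Across the cut, s < N \<le> t, the value \<open>\<phi> N\<close> separates:
    \<open>\<phi> s\<close> is above it and the tail at t is at most
    \<open>\<phi> N\<close>.\<close>
  moreover have "?\<psi> t < ?\<psi> s" if st: "0 < s" "s < t" for s t
  proof -
    have "\<phi> N * sqrt (N / t) \<le> \<phi> N * 1" if "N \<le> t"
      using pos[OF N] N that by (intro mult_left_mono) auto
    moreover have "\<phi> N * sqrt (N / t) < \<phi> N * sqrt (N / s)"
      using pos[OF N] N st by (intro mult_strict_left_mono) (auto simp: divide_strict_left_mono)
    ultimately show ?thesis
      using dec[of s t] dec[of s N] st by (cases "s < N"; cases "t < N") (auto simp: cut_density_def)
  qed
  moreover have "set_integrable lborel {0<..<x} ?\<psi>" if x: "0 < x" for x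
  proof -
    have "set_integrable lborel {0<..<N} ?\<psi>"
      using conc_density_integrable[OF d, of N]
        set_integrable_cong[OF refl refl, of "{0<..<N}" ?\<psi> \<phi> lborel]
      by (simp add: cut_density_def)
    moreover have "set_integrable lborel {N..x} (\<lambda>t. \<phi> N * sqrt (N / t))"
      unfolding set_integrable_def using N
      by (intro borel_integrable_compact) (auto intro!: continuous_intros)
    then have "set_integrable lborel {N..x} ?\<psi>"
      using set_integrable_cong[OF refl refl,
          of "{N..x}" ?\<psi> "\<lambda>t. \<phi> N * sqrt (N / t)" lborel]
      by (simp add: cut_density_def)
    \<comment> \<open>For x < N the second set is empty, but the first already covers
      \<open>{0<..<x}\<close>.\<close>
    ultimately have "set_integrable lborel ({0<..<N} \<union> {N..x}) ?\<psi>"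
      by (intro set_integrable_Un) auto
    then show ?thesis by (rule set_integrable_subset) auto
  qed
  moreover have "?\<psi> \<in> {0<..} \<rightarrow> {0<..}"
    using pos N by (auto simp: cut_density_def)
  ultimately show ?thesis by (auto simp: conc_density_def conc_of_density_def)
qed

text \<open>The integral up to x \<le> N sees only t < N, where the density is unchanged. This
  preserves the value at b and confines the distance integral to x > N.\<close>

lemma cut_conc_eq:
  assumes d: "conc_density \<phi> \<Phi>" and x: "0 \<le> x" "x \<le> N"
  shows "conc_of_density (cut_density N \<phi>) x = \<Phi> x"
proof -
  have "(LINT t:{0<..<x}|lborel. cut_density N \<phi> t) = (LINT t:{0<..<x}|lborel. \<phi> t)"
    using x by (intro set_lebesgue_integral_cong) (auto simp: cut_density_def)
  then show ?thesis using d x by (simp add: conc_of_density_def conc_density_def)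
qed

lemma cut_in_A_conc:
  assumes d: "conc_density \<phi> \<Phi>" and N: "1 \<le> N"
  shows "conc_of_density (cut_density N \<phi>) \<in> A_conc"
proof -
  let ?\<psi> = "cut_density N \<phi>"
  let ?g = "conc_of_density ?\<psi>"
  have c: "conc_density ?\<psi> ?g" using d N by (intro conc_density_cut) auto
  have \<phi>N: "0 < \<phi> N" using d N by (auto simp: conc_density_def)
  \<comment> \<open>For x \<ge> N the lower bound \<open>x * ?\<psi> x\<close> equals a positive
    constant times \<open>sqrt x\<close>.\<close>
  have "filterlim ?g at_top at_top"
  proof (rule filterlim_at_top_mono)
    have "filterlim (\<lambda>x. (\<phi> N * sqrt N) * sqrt x) at_top at_top"
      using \<phi>N N by (intro filterlim_tendsto_pos_mult_at_top[OF tendsto_const] sqrt_at_top) auto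
    then show "filterlim (\<lambda>x. \<phi> N * sqrt N * sqrt x) at_top at_top" .
    show "eventually (\<lambda>x. \<phi> N * sqrt N * sqrt x \<le> ?g x) at_top"
      using eventually_ge_at_top[of N]
    proof eventually_elim
      case (elim x)
      have "x * ?\<psi> x = \<phi> N * sqrt N * (x / sqrt x)"
        using elim by (simp add: cut_density_def real_sqrt_divide)
      also have "x / sqrt x = sqrt x" using elim N by (simp add: real_div_sqrt)
      finally show ?case using conc_density_lower_bound[OF c, of x] elim N by simp
    qed
  qed
  moreover have "?g \<in> {0..} \<rightarrow>\<^sub>E {0..}"
    using conc_density_nonneg[OF c] by (auto simp: conc_of_density_def)
  moreover have "set_integrable lborel {1..} (\<lambda>t. ?\<psi> t / t)"
  proof -
    have i32: "set_integrable lborel {N..} (\<lambda>t. \<phi> N * sqrt N * t powr (-3/2))"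
      using powr_tail(1)[of N "-3/2"] N by simp
    have i: "set_integrable lborel {1..N} ?\<psi>"
      \<comment> \<open>The bound \<open>N + 1\<close> makes the open interval contain the endpoint
        \<open>N\<close>.\<close>
      using conc_density_integrable[OF c, of "N + 1"] by (rule set_integrable_subset) auto
    have "set_integrable lborel {1..N} (\<lambda>t. ?\<psi> t / t)"
    proof (rule set_integrable_bound[OF i])
      have "(\<lambda>t. indicator {1..N} t *\<^sub>R ?\<psi> t / t) \<in> borel_measurable lborel"
        using i unfolding set_integrable_def by measurable
      then show "set_borel_measurable lborel {1..N} (\<lambda>t. ?\<psi> t / t)"
        by (simp add: set_borel_measurable_def)
      show "AE t in lborel. t \<in> {1..N} \<longrightarrow> norm (?\<psi> t / t) \<le> norm (?\<psi> t)"
        by (intro AE_I2) (auto simp: divide_le_eq mult_le_cancel_left1)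
    qed
    moreover have "set_integrable lborel {N..} (\<lambda>t. ?\<psi> t / t)"
    proof -
      have "\<phi> N * sqrt N * t powr (-3/2) = ?\<psi> t / t" if "t \<in> {N..}" for t
      proof -
        have t: "N \<le> t" "0 < t" using N that by auto
        have "t powr (-3/2) = t powr (-1/2) * t powr (-1)"
          using powr_add[of t "-1/2" "-1"] by simp
        also have "\<dots> = 1 / sqrt t / t"
          using t by (simp add: powr_minus powr_half_sqrt field_simps)
        finally show ?thesis
          using t by (simp add: cut_density_def real_sqrt_divide)
      qed
      then show ?thesis
        using i32 set_integrable_cong[OF refl refl,
          of "{N..}" "\<lambda>t. \<phi> N * sqrt N * t powr (-3/2)" "\<lambda>t. ?\<psi> t / t" lborel] by blast
    qed
    ultimately have "set_integrable lborel ({1..N} \<union> {N..}) (\<lambda>t. ?\<psi> t / t)"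
      by (intro set_integrable_Un) auto
    then show ?thesis by (rule set_integrable_subset) (use N in auto)
  qed
  ultimately show ?thesis using c by (auto simp: A_conc_def Y_conc_def)
qed

section \<open>Distance estimate and choice of the cut\<close>

lemma dist_conc_cut:
  assumes d: "conc_density \<phi> \<Phi>" and N: "1 < N"
  shows "(dist_conc \<Phi> (conc_of_density (cut_density N \<phi>)))\<^sup>2 \<le> (\<Phi> 1 + \<phi> 1)\<^sup>2 / N"
proof -
  let ?\<psi> = "cut_density N \<phi>"
  let ?g = "conc_of_density ?\<psi>"
  define C where "C = \<Phi> 1 + \<phi> 1"
  have c: "conc_density ?\<psi> ?g" using d N by (intro conc_density_cut) auto
  have \<phi>1: "0 < \<phi> 1" using d by (auto simp: conc_density_def)
  have \<Phi>1: "0 \<le> \<Phi> 1" using conc_density_nonneg[OF d] by simp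
  \<comment> \<open>The point 1 lies below the cut, so both functions obey the same linear bound and
    C does not depend on N.\<close>
  have g1: "?g 1 = \<Phi> 1" "?\<psi> 1 = \<phi> 1"
    using cut_conc_eq[OF d, of 1 N] N by (auto simp: cut_density_def)
  have bnd: "\<bar>\<Phi> x - ?g x\<bar> \<le> C * (x + 1)" if x: "0 \<le> x" for x
  proof -
    have "\<Phi> 1 + \<phi> 1 * x \<le> C * (x + 1)"
      using x \<phi>1 \<Phi>1 by (simp add: C_def algebra_simps)
    then show ?thesis
      using conc_density_nonneg[OF d x] conc_density_nonneg[OF c x]
        conc_density_upper_bound[OF d x] conc_density_upper_bound[OF c x] g1 by simp
  qed
  have "(LINT x:{0..}|lborel. (\<Phi> x - ?g x)\<^sup>2 / (x + 1) ^ 4)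
      \<le> (LINT x:{N..}|lborel. C\<^sup>2 * x powr -2)"
    unfolding set_lebesgue_integral_def
  \<comment> \<open>Integrability is established for the nonnegative majorant; a divergent left
    integral would count as 0, so the comparison is safe.\<close>
  proof (rule integral_mono')
    show "integrable lborel (\<lambda>x. indicator {N..} x *\<^sub>R (C\<^sup>2 * x powr -2))"
      using powr_tail(1)[of N "-2"] N unfolding set_integrable_def[symmetric] by simp
    fix x :: real
    show "0 \<le> indicator {N..} x *\<^sub>R (C\<^sup>2 * x powr -2)" by simp
    show "indicator {0..} x *\<^sub>R ((\<Phi> x - ?g x)\<^sup>2 / (x + 1) ^ 4)
        \<le> indicator {N..} x *\<^sub>R (C\<^sup>2 * x powr -2)"
    proof (cases "N \<le> x")
      case True
      then have x: "0 < x" using N by simp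
      have "(\<Phi> x - ?g x)\<^sup>2 \<le> (C * (x + 1))\<^sup>2"
        using power_mono[OF bnd, of x 2] x by simp
      then have "(\<Phi> x - ?g x)\<^sup>2 / (x + 1) ^ 4 \<le> (C * (x + 1))\<^sup>2 / (x + 1) ^ 4"
        using x by (intro divide_right_mono) auto
      also have "\<dots> = C\<^sup>2 / (x + 1)\<^sup>2"
        using x by (simp add: power_mult_distrib power4_eq_xxxx power2_eq_square)
      also have "\<dots> \<le> C\<^sup>2 / x\<^sup>2"
        using x by (intro divide_left_mono power_mono) auto
      also have "\<dots> = C\<^sup>2 * x powr -2"
        using x by (simp add: powr_minus divide_inverse)
      finally show ?thesis using True x by simp
    next
      case False
      then show ?thesis using cut_conc_eq[OF d, of x N] by (auto simp: indicator_def)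
    qed
  qed
  also have "\<dots> = C\<^sup>2 / N"
    using powr_tail(2)[of N "-2"] N by (simp add: powr_minus divide_inverse)
  finally have "(LINT x:{0..}|lborel. (\<Phi> x - ?g x)\<^sup>2 / (x + 1) ^ 4) \<le> C\<^sup>2 / N" .
  \<comment> \<open>Nonnegativity lets the square cancel the root in
    \<open>dist_conc\<close>.\<close>
  moreover have "0 \<le> (LINT x:{0..}|lborel. (\<Phi> x - ?g x)\<^sup>2 / (x + 1) ^ 4)"
    unfolding set_lebesgue_integral_def by (intro integral_nonneg_AE AE_I2) (auto simp: indicator_def)
  ultimately show ?thesis by (simp add: dist_conc_def C_def)
qed

theorem theorem7:
  fixes b :: real
  assumes "0 < b"
  shows "A_at b \<subseteq> Y_at b \<and>
    (\<forall>f \<in> Y_at b. \<forall>\<epsilon>>0. \<exists>g \<in> A_at b. dist_conc f g < \<epsilon>)"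
proof (intro conjI ballI allI impI)
  show "A_at b \<subseteq> Y_at b" by (auto simp: A_at_def Y_at_def A_conc_def)
  fix f and \<epsilon> :: real
  assume f: "f \<in> Y_at b" and \<epsilon>: "0 < \<epsilon>"
  obtain \<phi> where d: "conc_density \<phi> f" using f by (auto simp: Y_at_def Y_conc_def)
  \<comment> \<open>The three summands make N exceed 1, keep b below the cut so that the value there
    stays b, and push the squared distance below \<open>\<epsilon>\<^sup>2\<close>.\<close>
  define N where "N = 1 + b + (f 1 + \<phi> 1)\<^sup>2 / \<epsilon>\<^sup>2"
  let ?g = "conc_of_density (cut_density N \<phi>)"
  have N: "1 < N" "b \<le> N" "(f 1 + \<phi> 1)\<^sup>2 / \<epsilon>\<^sup>2 < N"
    using assms by (auto simp: N_def add_pos_nonneg)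
  have "?g b = b" using cut_conc_eq[OF d, of b N] f assms N by (simp add: Y_at_def)
  then have g: "?g \<in> A_at b" using cut_in_A_conc[OF d, of N] N by (simp add: A_at_def)
  have "(dist_conc f ?g)\<^sup>2 \<le> (f 1 + \<phi> 1)\<^sup>2 / N" using dist_conc_cut[OF d N(1)] .
  also have "\<dots> < \<epsilon>\<^sup>2" using N \<epsilon> by (simp add: field_simps)
  finally have "dist_conc f ?g < \<epsilon>" using \<epsilon> by (simp add: power2_less_imp_less)
  then show "\<exists>g \<in> A_at b. dist_conc f g < \<epsilon>" using g by blast
qed

end
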